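(* Let $E\colon 0\to M\xrightarrow{i}E\xrightarrow{p}A\to 0$ be an abelian extension of an algebra with bracket $A$ by its representation $M$. Then there is an exact sequence of vector spaces $$0\to Z^{-1}(A,M)\xrightarrow{\ \sigma\ }\mathrm{Der}_{\mathsf{AWB}}(E|M)\xrightarrow{\ \kappa\ }D_{\mathsf{AWB}}(M,A)\xrightarrow{\ \omega\ }H^1_{\mathsf{AWB}}(A,M),$$ where $\omega$ is the Wells map of the extension, $\kappa$ is the map $d_E\mapsto(d_E|_M,\ p\circ d_E\circ s)$ (for any linear section $s$ of $p$), and $\sigma$ is some linear map.
   Context: Fix a field $\mathbb K$; all vector spaces, algebras and linear maps are over $\mathbb K$. An algebra with bracket (AWB) is an associative (not necessarily commutative or unital) algebra $A$ with a bilinear map $[-,-]\colon A\times A\to A$ such that $[ab,c]=[a,c]b+a[b,c]$ for all $a,b,c\in A$. Homomorphisms preserve product and bracket. An AWB is abelian if its product and bracket are zero; any vector space is regarded as an abelian AWB. A representation of $A$ is a vector space $M$ with four bilinear maps $A\times M\to M$, $(a,m)\mapsto a\cdot m$ and $(a,m)\mapsto\{a,m\}$, and $M\times A\to M$, $(m,a)\mapsto m\cdot a$ and $(m,a)\mapsto\{m,a\}$, such that $(a_1a_2)\cdot m=a_1\cdot(a_2\cdot m)$, $m\cdot(a_1a_2)=(m\cdot a_1)\cdot a_2$, $(a_1\cdot m)\cdot a_2=a_1\cdot(m\cdot a_2)$, $\{a_1\cdot m,a_2\}=a_1\cdot\{m,a_2\}+[a_1,a_2]\cdot m$, $\{m\cdot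 a_1,a_2\}=\{m,a_2\}\cdot a_1+m\cdot[a_1,a_2]$, $\{a_1a_2,m\}=a_1\cdot\{a_2,m\}+\{a_1,m\}\cdot a_2$. An abelian extension of $A$ by $M$ is a short exact sequence of AWBs $0\to M\xrightarrow{i}E\xrightarrow{p}A\to0$ with $M$ regarded as an abelian AWB, which induces the given representation structure on $M$: for any $e\in E$ with $p(e)=a$ one has $i(a\cdot m)=e\,i(m)$, $i(m\cdot a)=i(m)e$, $i\{a,m\}=[e,i(m)]$, $i\{m,a\}=[i(m),e]$. (The letter $E$ denotes both the extension and its middle term; $M$ is identified with $i(M)$.) For an AWB $X$, $\mathrm{Der}_{\mathsf{AWB}}(X)$ is the space of linear maps $d\colon X\to X$ with $d(xy)=x\,d(y)+d(x)y$ and $d[x,y]=[x,d(y)]+[d(x),y]$; thus $\mathrm{Der}_{\mathsf{AWB}}(M)=\mathrm{End}_{\mathbb K}(M)$ for the abelian AWB $M$. Put $\mathrm{Der}_{\mathsf{AWB}}(E|M)=\{d_E\in\mathrm{Der}_{\mathsf{AWB}}(E)\mid d_E(M)\subseteq M\}$. $D_{\mathsf{AWB}}(M,A)$ is the vector space of pairs $(d_M,d_A)\in\mathrm{Der}_{\mathsf{AWB}}(M)\times\mathrm{Der}_{\mathsf{AWB}}(A)$ such that for all $a\in A$, $m\in M$: $d_M(a\cdot m)=a\cdot d_M(m)+d_A(a)\cdot m$, $d_M(m\cdot a)=m\cdot d_A(a)+d_M(m)\cdot a$, $d_M\{a,m\}=\{a,d_M(m)\}+\{d_A(a),m\}$,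 $d_M\{m,a\}=\{m,d_A(a)\}+\{d_M(m),a\}$. The map $\kappa$ takes values in $D_{\mathsf{AWB}}(M,A)$ and does not depend on $s$. Cohomology: a $0$-cochain is a pair $(f,g)$ of linear maps $f\colon A^{\otimes2}\to M$, $g\colon A\to\mathrm{Hom}(A,M)$. It is a $0$-cocycle if for all $a_0,a_1,a_2\in A$ $$a_0\cdot f(a_1,a_2)-f(a_0a_1,a_2)+f(a_0,a_1a_2)-f(a_0,a_1)\cdot a_2=0,$$ $$a_0\cdot g(a_1)(a_2)+g(a_0)(a_2)\cdot a_1-g(a_0a_1)(a_2)=\{f(a_0,a_1),a_2\}-f([a_0,a_2],a_1)-f(a_0,[a_1,a_2]).$$ For a linear map $h\colon A\to M$ (a $(-1)$-cochain), $\partial^{-1}(h)$ is the pair $(f,g)$ with $f(a_0,a_1)=-a_0\cdot h(a_1)+h(a_0a_1)-h(a_0)\cdot a_1$ and $g(a_0)(a_1)=-\{a_0,h(a_1)\}+h[a_0,a_1]-\{h(a_0),a_1\}$. $H^1_{\mathsf{AWB}}(A,M)$ is the quotient of the space of $0$-cocycles by the image of $\partial^{-1}$; $\mathrm{cl}$ denotes classes. $Z^{-1}(A,M)=\ker\partial^{-1}$ is the vector space of $(-1)$-cocycles, i.e. linear maps $h\colon A\to M$ with $a_0\cdot h(a_1)-h(a_0a_1)+h(a_0)\cdot a_1=0$ and $\{a_0,h(a_1)\}-h[a_0,a_1]+\{h(a_0),a_1\}=0$ for all $a_0,a_1\in A$. Wells map: choose a linear section $s\colon A\to E$ of $p$ and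 set $f(a_0,a_1)=i^{-1}(s(a_0)s(a_1)-s(a_0a_1))$, $g(a_0)(a_1)=i^{-1}([s(a_0),s(a_1)]-s[a_0,a_1])$; this is a $0$-cocycle whose class does not depend on $s$. Then $\omega(d_M,d_A)=\mathrm{cl}(f_\theta,g_\theta)$, where $$f_\theta(a_0,a_1)=d_M(f(a_0,a_1))-f(d_A(a_0),a_1)-f(a_0,d_A(a_1)),$$ $$g_\theta(a_0)(a_1)=d_M(g(a_0)(a_1))-g(d_A(a_0))(a_1)-g(a_0)(d_A(a_1)).$$ This is a well-defined linear map. *)

theory Defs
  imports
    "Jordan_Normal_Form.VS_Connect"
    "HOL-Algebra.AbelCoset"
    "HOL-Library.Function_Algebras"
    "HOL-Library.Product_Plus"
begin

text \<open>
  The ground field is a type of class \<open>field\<close>. The spaces underlying \<open>A\<close>, \<open>M\<close> and \<open>E\<close> are whole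
  types with an explicit scalar multiplication. The spaces derived from them (derivations, cocycles,
  cohomology) are subspaces or quotients, and are therefore carrier-based vector spaces over
  \<open>class_ring\<close>, the ground field seen as a ring record.
\<close>

definition bilinear_map ::
  "('k::field \<Rightarrow> 'x::ab_group_add \<Rightarrow> 'x) \<Rightarrow> ('k \<Rightarrow> 'y::ab_group_add \<Rightarrow> 'y) \<Rightarrow>
   ('k \<Rightarrow> 'z::ab_group_add \<Rightarrow> 'z) \<Rightarrow> ('x \<Rightarrow> 'y \<Rightarrow> 'z) \<Rightarrow> bool" where
  "bilinear_map sX sY sZ B \<longleftrightarrow>
     (\<forall>x. Vector_Spaces.linear sY sZ (\<lambda>y. B x y)) \<and>
     (\<forall>y. Vector_Spaces.linear sX sZ (\<lambda>x. B x y))"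


subsection \<open>Algebras with bracket\<close>

record ('k, 'a) awb =
  scl :: "'k \<Rightarrow> 'a \<Rightarrow> 'a"
  mul :: "'a \<Rightarrow> 'a \<Rightarrow> 'a"
  br :: "'a \<Rightarrow> 'a \<Rightarrow> 'a"

locale awb_algebra = vector_space "scl A"
  for A :: "('k::field, 'a::ab_group_add) awb" +
  assumes bilinear_mul: "bilinear_map (scl A) (scl A) (scl A) (mul A)"
    and bilinear_br: "bilinear_map (scl A) (scl A) (scl A) (br A)"
    and mul_assoc: "mul A (mul A x y) z = mul A x (mul A y z)"
    and br_mul: "br A (mul A x y) z = mul A (br A x z) y + mul A x (br A y z)"

definition awb_hom ::
  "('k::field, 'a::ab_group_add) awb \<Rightarrow> ('k, 'b::ab_group_add) awb \<Rightarrow> ('a \<Rightarrow> 'b) \<Rightarrow> bool" where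
  "awb_hom A B f \<longleftrightarrow>
     Vector_Spaces.linear (scl A) (scl B) f \<and>
     (\<forall>x y. f (mul A x y) = mul B (f x) (f y)) \<and>
     (\<forall>x y. f (br A x y) = br B (f x) (f y))"

definition abelian_awb :: "('k::field \<Rightarrow> 'm::ab_group_add \<Rightarrow> 'm) \<Rightarrow> ('k, 'm) awb" where
  "abelian_awb s = \<lparr>scl = s, mul = (\<lambda>_ _. 0), br = (\<lambda>_ _. 0)\<rparr>"

definition Der_AWB :: "('k::field, 'a::ab_group_add) awb \<Rightarrow> ('a \<Rightarrow> 'a) set" where
  "Der_AWB X = {d. Vector_Spaces.linear (scl X) (scl X) d \<and>
     (\<forall>x y. d (mul X x y) = mul X x (d y) + mul X (d x) y) \<and>
     (\<forall>x y. d (br X x y) = br X x (d y) + br X (d x) y)}"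


subsection \<open>Representations and abelian extensions\<close>

text \<open>\<open>lact M a m\<close>, \<open>ract M m a\<close>, \<open>lbr M a m\<close>, \<open>rbr M m a\<close> stand for
  \<open>a \<cdot> m\<close>, \<open>m \<cdot> a\<close>, \<open>{a, m}\<close>, \<open>{m, a}\<close>.\<close>

record ('k, 'a, 'm) awb_rep =
  rscl :: "'k \<Rightarrow> 'm \<Rightarrow> 'm"
  lact :: "'a \<Rightarrow> 'm \<Rightarrow> 'm"
  ract :: "'m \<Rightarrow> 'a \<Rightarrow> 'm"
  lbr :: "'a \<Rightarrow> 'm \<Rightarrow> 'm"
  rbr :: "'m \<Rightarrow> 'a \<Rightarrow> 'm"

locale awb_representation = alg: awb_algebra A + rep: vector_space "rscl M"
  for A :: "('k::field, 'a::ab_group_add) awb"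
  and M :: "('k, 'a, 'm::ab_group_add) awb_rep" +
  assumes bilinear_lact: "bilinear_map (scl A) (rscl M) (rscl M) (lact M)"
    and bilinear_ract: "bilinear_map (rscl M) (scl A) (rscl M) (ract M)"
    and bilinear_lbr: "bilinear_map (scl A) (rscl M) (rscl M) (lbr M)"
    and bilinear_rbr: "bilinear_map (rscl M) (scl A) (rscl M) (rbr M)"
    and lact_mul: "lact M (mul A a1 a2) m = lact M a1 (lact M a2 m)"
    and ract_mul: "ract M m (mul A a1 a2) = ract M (ract M m a1) a2"
    and lact_ract: "ract M (lact M a1 m) a2 = lact M a1 (ract M m a2)"
    and rbr_lact: "rbr M (lact M a1 m) a2 = lact M a1 (rbr M m a2) + lact M (br A a1 a2) m"
    and rbr_ract: "rbr M (ract M m a1) a2 = ract M (rbr M m a2) a1 + ract M m (br A a1 a2)"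
    and lbr_mul: "lbr M (mul A a1 a2) m = lact M a1 (lbr M a2 m) + ract M (lbr M a1 m) a2"

locale abelian_extension = rep: awb_representation A M + ext: awb_algebra E
  for A :: "('k::field, 'a::ab_group_add) awb"
  and M :: "('k, 'a, 'm::ab_group_add) awb_rep"
  and E :: "('k, 'e::ab_group_add) awb"
  and i :: "'m \<Rightarrow> 'e"
  and p :: "'e \<Rightarrow> 'a" +
  assumes hom_i: "awb_hom (abelian_awb (rscl M)) E i"
    and hom_p: "awb_hom E A p"
    and inj_i: "inj i"
    and exact_at_E: "range i = {e. p e = 0}"
    and surj_p: "surj p"
    and induced_lact: "i (lact M (p e) m) = mul E e (i m)"
    and induced_ract: "i (ract M m (p e)) = mul E (i m) e"
    and induced_lbr: "i (lbr M (p e) m) = br E e (i m)"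
    and induced_rbr: "i (rbr M m (p e)) = br E (i m) e"

definition linear_section ::
  "('k::field, 'a::ab_group_add) awb \<Rightarrow> ('k, 'e::ab_group_add) awb \<Rightarrow> ('e \<Rightarrow> 'a) \<Rightarrow>
   ('a \<Rightarrow> 'e) \<Rightarrow> bool" where
  "linear_section A E p s \<longleftrightarrow> Vector_Spaces.linear (scl A) (scl E) s \<and> (\<forall>a. p (s a) = a)"


subsection \<open>Carrier-based subspaces and quotients\<close>

text \<open>The record type \<open>module\<close> extends \<open>ring\<close>; its fields \<open>mult\<close> and \<open>one\<close> play no role.\<close>

definition subspace_vs :: "('k \<Rightarrow> 'v::ab_group_add \<Rightarrow> 'v) \<Rightarrow> 'v set \<Rightarrow> ('k, 'v) module" where
  "subspace_vs sV U =
     \<lparr>carrier = U, mult = undefined, one = undefined, zero = 0, add = (+), smult = sV\<rparr>"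

text \<open>The quotient of \<open>V\<close> by the subspace \<open>B\<close>, in the style of \<open>FactRing\<close>: its elements are the
  cosets \<open>B +>\<^bsub>V\<^esub> x\<close>.\<close>

definition quotient_vs :: "('k, 'v) module \<Rightarrow> 'v set \<Rightarrow> ('k, 'v set) module" where
  "quotient_vs V B =
     \<lparr>carrier = a_rcosets\<^bsub>V\<^esub> B, mult = undefined, one = undefined, zero = B, add = set_add V,
      smult = (\<lambda>k X. \<Union>x\<in>X. B +>\<^bsub>V\<^esub> (k \<odot>\<^bsub>V\<^esub> x))\<rparr>"

definition fun_scl :: "('k \<Rightarrow> 'v \<Rightarrow> 'v) \<Rightarrow> 'k \<Rightarrow> ('x \<Rightarrow> 'v) \<Rightarrow> 'x \<Rightarrow> 'v" where
  "fun_scl sV k f = (\<lambda>x. sV k (f x))"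

definition pair_scl ::
  "('k \<Rightarrow> 'v \<Rightarrow> 'v) \<Rightarrow> ('k \<Rightarrow> 'w \<Rightarrow> 'w) \<Rightarrow> 'k \<Rightarrow> 'v \<times> 'w \<Rightarrow> 'v \<times> 'w" where
  "pair_scl sV sW k v = (sV k (fst v), sW k (snd v))"


subsection \<open>Spaces of derivations\<close>

definition Der_rel ::
  "('k::field, 'e::ab_group_add) awb \<Rightarrow> ('m \<Rightarrow> 'e) \<Rightarrow> ('k, 'e \<Rightarrow> 'e) module" where
  "Der_rel E i =
     subspace_vs (fun_scl (scl E)) {d \<in> Der_AWB E. d ` range i \<subseteq> range i}"

definition D_AWB ::
  "('k::field, 'a::ab_group_add) awb \<Rightarrow> ('k, 'a, 'm::ab_group_add) awb_rep \<Rightarrow>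
   ('k, ('m \<Rightarrow> 'm) \<times> ('a \<Rightarrow> 'a)) module" where
  "D_AWB A M = subspace_vs (pair_scl (fun_scl (rscl M)) (fun_scl (scl A)))
     {(dM, dA). dM \<in> Der_AWB (abelian_awb (rscl M)) \<and> dA \<in> Der_AWB A \<and>
        (\<forall>a m. dM (lact M a m) = lact M a (dM m) + lact M (dA a) m) \<and>
        (\<forall>a m. dM (ract M m a) = ract M m (dA a) + ract M (dM m) a) \<and>
        (\<forall>a m. dM (lbr M a m) = lbr M a (dM m) + lbr M (dA a) m) \<and>
        (\<forall>a m. dM (rbr M m a) = rbr M m (dA a) + rbr M (dM m) a)}"


subsection \<open>Cohomology\<close>

text \<open>Both components of a 0-cochain \<open>(f, g)\<close> are curried bilinear maps from \<open>A\<close> to \<open>M\<close>: linear maps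
  on the tensor square of \<open>A\<close> for \<open>f\<close>, linear maps from \<open>A\<close> to \<open>Hom(A, M)\<close> for \<open>g\<close>.\<close>

definition cocycles0 ::
  "('k::field, 'a::ab_group_add) awb \<Rightarrow> ('k, 'a, 'm::ab_group_add) awb_rep \<Rightarrow>
   ('k, ('a \<Rightarrow> 'a \<Rightarrow> 'm) \<times> ('a \<Rightarrow> 'a \<Rightarrow> 'm)) module" where
  "cocycles0 A M =
     subspace_vs (pair_scl (fun_scl (fun_scl (rscl M))) (fun_scl (fun_scl (rscl M))))
     {(f, g). bilinear_map (scl A) (scl A) (rscl M) f \<and> bilinear_map (scl A) (scl A) (rscl M) g \<and>
        (\<forall>a0 a1 a2. lact M a0 (f a1 a2) - f (mul A a0 a1) a2 + f a0 (mul A a1 a2)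
                     - ract M (f a0 a1) a2 = 0) \<and>
        (\<forall>a0 a1 a2. lact M a0 (g a1 a2) + ract M (g a0 a2) a1 - g (mul A a0 a1) a2
                     = rbr M (f a0 a1) a2 - f (br A a0 a2) a1 - f a0 (br A a1 a2))}"

definition coboundary ::
  "('k::field, 'a::ab_group_add) awb \<Rightarrow> ('k, 'a, 'm::ab_group_add) awb_rep \<Rightarrow>
   ('a \<Rightarrow> 'm) \<Rightarrow> ('a \<Rightarrow> 'a \<Rightarrow> 'm) \<times> ('a \<Rightarrow> 'a \<Rightarrow> 'm)" where
  "coboundary A M h =
     ((\<lambda>a0 a1. - lact M a0 (h a1) + h (mul A a0 a1) - ract M (h a0) a1),
      (\<lambda>a0 a1. - lbr M a0 (h a1) + h (br A a0 a1) - rbr M (h a0) a1))"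

definition coboundaries0 ::
  "('k::field, 'a::ab_group_add) awb \<Rightarrow> ('k, 'a, 'm::ab_group_add) awb_rep \<Rightarrow>
   (('a \<Rightarrow> 'a \<Rightarrow> 'm) \<times> ('a \<Rightarrow> 'a \<Rightarrow> 'm)) set" where
  "coboundaries0 A M = coboundary A M ` {h. Vector_Spaces.linear (scl A) (rscl M) h}"

definition cocycles_neg1 ::
  "('k::field, 'a::ab_group_add) awb \<Rightarrow> ('k, 'a, 'm::ab_group_add) awb_rep \<Rightarrow>
   ('k, 'a \<Rightarrow> 'm) module" where
  "cocycles_neg1 A M = subspace_vs (fun_scl (rscl M))
     {h. Vector_Spaces.linear (scl A) (rscl M) h \<and> coboundary A M h = 0}"

definition H1_AWB ::
  "('k::field, 'a::ab_group_add) awb \<Rightarrow> ('k, 'a, 'm::ab_group_add) awb_rep \<Rightarrow>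
   ('k, (('a \<Rightarrow> 'a \<Rightarrow> 'm) \<times> ('a \<Rightarrow> 'a \<Rightarrow> 'm)) set) module" where
  "H1_AWB A M = quotient_vs (cocycles0 A M) (coboundaries0 A M)"

definition cl ::
  "('k::field, 'a::ab_group_add) awb \<Rightarrow> ('k, 'a, 'm::ab_group_add) awb_rep \<Rightarrow>
   ('a \<Rightarrow> 'a \<Rightarrow> 'm) \<times> ('a \<Rightarrow> 'a \<Rightarrow> 'm) \<Rightarrow> (('a \<Rightarrow> 'a \<Rightarrow> 'm) \<times> ('a \<Rightarrow> 'a \<Rightarrow> 'm)) set" where
  "cl A M c = coboundaries0 A M +>\<^bsub>cocycles0 A M\<^esub> c"


subsection \<open>The maps of the sequence, computed from a linear section\<close>

definition section_cocycle ::
  "('k::field, 'a::ab_group_add) awb \<Rightarrow> ('k, 'e::ab_group_add) awb \<Rightarrow> ('m \<Rightarrow> 'e) \<Rightarrow> ('a \<Rightarrow> 'e) \<Rightarrow>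
   ('a \<Rightarrow> 'a \<Rightarrow> 'm) \<times> ('a \<Rightarrow> 'a \<Rightarrow> 'm)" where
  "section_cocycle A E i s =
     ((\<lambda>a0 a1. inv_into UNIV i (mul E (s a0) (s a1) - s (mul A a0 a1))),
      (\<lambda>a0 a1. inv_into UNIV i (br E (s a0) (s a1) - s (br A a0 a1))))"

definition theta ::
  "('m \<Rightarrow> 'm) \<Rightarrow> ('a \<Rightarrow> 'a) \<Rightarrow> ('a \<Rightarrow> 'a \<Rightarrow> 'm::ab_group_add) \<Rightarrow> 'a \<Rightarrow> 'a \<Rightarrow> 'm" where
  "theta dM dA f = (\<lambda>a0 a1. dM (f a0 a1) - f (dA a0) a1 - f a0 (dA a1))"

definition wells_via ::
  "('k::field, 'a::ab_group_add) awb \<Rightarrow> ('k, 'a, 'm::ab_group_add) awb_rep \<Rightarrow>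
   ('k, 'e::ab_group_add) awb \<Rightarrow> ('m \<Rightarrow> 'e) \<Rightarrow> ('a \<Rightarrow> 'e) \<Rightarrow>
   ('m \<Rightarrow> 'm) \<times> ('a \<Rightarrow> 'a) \<Rightarrow> (('a \<Rightarrow> 'a \<Rightarrow> 'm) \<times> ('a \<Rightarrow> 'a \<Rightarrow> 'm)) set" where
  "wells_via A M E i s = (\<lambda>(dM, dA). case section_cocycle A E i s of
     (f, g) \<Rightarrow> cl A M (theta dM dA f, theta dM dA g))"

text \<open>The restriction of \<open>d\<close> to \<open>M\<close>, identified with \<open>range i\<close>, is \<open>inv_into UNIV i \<circ> d \<circ> i\<close>.\<close>

definition kappa_via ::
  "('m \<Rightarrow> 'e) \<Rightarrow> ('e \<Rightarrow> 'a) \<Rightarrow> ('a \<Rightarrow> 'e) \<Rightarrow> ('e \<Rightarrow> 'e) \<Rightarrow> ('m \<Rightarrow> 'm) \<times> ('a \<Rightarrow> 'a)" where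
  "kappa_via i p s d = (inv_into UNIV i \<circ> d \<circ> i, p \<circ> d \<circ> s)"

end

theory Submission
  imports Defs
begin

text \<open>
  Fix a linear section \<open>s\<close>, so that every element of \<open>E\<close> is \<open>s a + i m\<close>, and take \<open>\<sigma> h = i \<circ> h \<circ> p\<close>.
  A derivation of \<open>E\<close> killed by \<open>\<kappa>\<close> vanishes on \<open>M\<close> and has values in \<open>M\<close>, hence has this form.
  If \<open>d\<close> is a derivation over \<open>(d\<^sub>M, d\<^sub>A)\<close>, then \<open>s \<circ> d\<^sub>A - d \<circ> s = i \<circ> h\<close> for a linear \<open>h\<close> whose
  coboundary is \<open>(f\<^sub>\<theta>, g\<^sub>\<theta>)\<close>; conversely, if \<open>(f\<^sub>\<theta>, g\<^sub>\<theta>)\<close> is the coboundary of \<open>h\<close>, then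
  \<open>s a + i m \<mapsto> s (d\<^sub>A a) - i (h a) + i (d\<^sub>M m)\<close> is a derivation of \<open>E\<close> over \<open>(d\<^sub>M, d\<^sub>A)\<close>.
\<close>

section \<open>Carrier-based subspaces and quotients\<close>

lemma subspace_vs_simps [simp]:
  "carrier (subspace_vs s U) = U"
  "zero (subspace_vs s U) = 0"
  "add (subspace_vs s U) = (+)"
  "module.smult (subspace_vs s U) = s"
  by (simp_all add: subspace_vs_def)

lemma linearD:
  assumes "Vector_Spaces.linear s1 s2 f"
  shows "f (x + y) = f x + f y" "f (x - y) = f x - f y" "f (- x) = - f x" "f 0 = 0"
    "f (s1 c x) = s2 c (f x)"
proof -
  interpret f: Vector_Spaces.linear s1 s2 f by fact
  show "f (x + y) = f x + f y" "f (x - y) = f x - f y" "f (- x) = - f x" "f 0 = 0"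
    "f (s1 c x) = s2 c (f x)"
    by (fact f.add f.diff f.neg f.zero f.scale)+
qed

lemma bilinear_mapD:
  assumes "bilinear_map sX sY sZ B"
  shows "B (x + x') y = B x y + B x' y" "B (x - x') y = B x y - B x' y" "B (- x) y = - B x y"
    "B 0 y = 0" "B (sX c x) y = sZ c (B x y)"
    "B x (y + y') = B x y + B x y'" "B x (y - y') = B x y - B x y'" "B x (- y) = - B x y"
    "B x 0 = 0" "B x (sY c y) = sZ c (B x y)"
proof -
  have x: "Vector_Spaces.linear sX sZ (\<lambda>x. B x y)" for y
    using assms by (simp add: bilinear_map_def)
  have y: "Vector_Spaces.linear sY sZ (B x)" for x
    using assms by (simp add: bilinear_map_def)
  show "B (x + x') y = B x y + B x' y" "B (x - x') y = B x y - B x' y" "B (- x) y = - B x y"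
    "B 0 y = 0" "B (sX c x) y = sZ c (B x y)"
    by (fact linearD[OF x])+
  show "B x (y + y') = B x y + B x y'" "B x (y - y') = B x y - B x y'" "B x (- y) = - B x y"
    "B x 0 = 0" "B x (sY c y) = sZ c (B x y)"
    by (fact linearD[OF y])+
qed

locale linear_subspace = vector_space scale
  for scale :: "'k::field \<Rightarrow> 'v::ab_group_add \<Rightarrow> 'v" +
  fixes U :: "'v set"
  assumes zero_mem: "0 \<in> U"
    and add_mem: "x \<in> U \<Longrightarrow> y \<in> U \<Longrightarrow> x + y \<in> U"
    and scale_mem: "x \<in> U \<Longrightarrow> scale c x \<in> U"
begin

lemma neg_mem: "x \<in> U \<Longrightarrow> - x \<in> U"
  using scale_mem[of x "- 1"] by simp

lemma diff_mem: "x \<in> U \<Longrightarrow> y \<in> U \<Longrightarrow> x - y \<in> U"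
  using add_mem[of x "- y"] neg_mem by simp

lemma vectorspace_subspace_vs: "vectorspace class_ring (subspace_vs scale U)"
proof -
  have "\<exists>y\<in>U. y + x = 0" if "x \<in> U" for x
    using neg_mem[OF that] by (intro bexI[of _ "- x"]) simp_all
  then have "abelian_group (subspace_vs scale U)"
    by (intro abelian_groupI) (simp_all add: zero_mem add_mem add.assoc add.commute)
  then have "module class_ring (subspace_vs scale U)"
    by (intro moduleI class_cring.is_cring)
      (auto simp: scale_mem scale_left_distrib scale_right_distrib)
  then show ?thesis
    by (intro vectorspace.intro class_field)
qed

end

section \<open>Quotients by a subspace\<close>

locale subspace_quotient = linear_subspace scale U + sub: linear_subspace scale B
  for scale :: "'k::field \<Rightarrow> 'v::ab_group_add \<Rightarrow> 'v" and U B :: "'v set" +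
  assumes sub: "B \<subseteq> U"
begin

abbreviation (input) "V \<equiv> subspace_vs scale U"

text \<open>Turns cosets into sets of differences, so that all later questions about cosets become
  membership questions for \<open>B\<close>.\<close>

lemma coset_eq: "B +>\<^bsub>V\<^esub> x = {y. y - x \<in> B}"
proof -
  have "y \<in> B +>\<^bsub>V\<^esub> x \<longleftrightarrow> y - x \<in> B" for y
    unfolding a_r_coset_def' by (auto intro!: bexI[of _ "y - x"])
  then show ?thesis by blast
qed

lemma coset_eq_iff: "B +>\<^bsub>V\<^esub> x = B +>\<^bsub>V\<^esub> y \<longleftrightarrow> x - y \<in> B"
proof
  assume "B +>\<^bsub>V\<^esub> x = B +>\<^bsub>V\<^esub> y"
  moreover have "x \<in> B +>\<^bsub>V\<^esub> x" by (simp add: coset_eq sub.zero_mem)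
  ultimately show "x - y \<in> B" by (simp add: coset_eq)
next
  assume *: "x - y \<in> B"
  have "z - x \<in> B \<longleftrightarrow> z - y \<in> B" for z
    using sub.add_mem[OF _ *, of "z - x"] sub.diff_mem[OF _ *, of "z - y"] by auto
  then show "B +>\<^bsub>V\<^esub> x = B +>\<^bsub>V\<^esub> y" by (simp add: coset_eq)
qed

lemma coset_zero: "B +>\<^bsub>V\<^esub> 0 = B"
  by (simp add: coset_eq)

lemma coset_eq_zero_iff: "B +>\<^bsub>V\<^esub> x = B \<longleftrightarrow> x \<in> B"
  using coset_eq_iff[of x 0] by (simp add: coset_zero)

lemma coset_add: "(B +>\<^bsub>V\<^esub> x) <+>\<^bsub>V\<^esub> (B +>\<^bsub>V\<^esub> y) = B +>\<^bsub>V\<^esub> (x + y)"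
proof -
  have "z \<in> (B +>\<^bsub>V\<^esub> x) <+>\<^bsub>V\<^esub> (B +>\<^bsub>V\<^esub> y) \<longleftrightarrow> z - (x + y) \<in> B" for z
  proof
    assume "z \<in> (B +>\<^bsub>V\<^esub> x) <+>\<^bsub>V\<^esub> (B +>\<^bsub>V\<^esub> y)"
    then obtain u v where "z = u + v" "u - x \<in> B" "v - y \<in> B"
      by (auto simp: set_add_def set_mult_def coset_eq)
    then show "z - (x + y) \<in> B"
      using sub.add_mem[of "u - x" "v - y"] by (simp add: algebra_simps)
  next
    assume "z - (x + y) \<in> B"
    then have "z = (z - y) + y" "z - y - x \<in> B" "y - y \<in> B"
      by (simp_all add: sub.zero_mem algebra_simps)
    then show "z \<in> (B +>\<^bsub>V\<^esub> x) <+>\<^bsub>V\<^esub> (B +>\<^bsub>V\<^esub> y)"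
      unfolding set_add_def set_mult_def coset_eq by (auto simp del: diff_self)
  qed
  then show ?thesis by (auto simp: coset_eq)
qed

lemma quotient_simps [simp]:
  "carrier (quotient_vs V B) = (\<lambda>x. B +>\<^bsub>V\<^esub> x) ` U"
  "zero (quotient_vs V B) = B"
  "add (quotient_vs V B) = set_add V"
  by (auto simp: quotient_vs_def A_RCOSETS_def RCOSETS_def a_r_coset_def)

text \<open>\<open>quotient_vs\<close> scales a coset by a union over all its representatives. Since
  \<open>B\<close> is closed under scaling, every representative contributes the same coset.\<close>

lemma quotient_smult: "c \<odot>\<^bsub>quotient_vs V B\<^esub> (B +>\<^bsub>V\<^esub> x) = B +>\<^bsub>V\<^esub> scale c x"
proof -
  have "B +>\<^bsub>V\<^esub> scale c y = B +>\<^bsub>V\<^esub> scale c x" if "y \<in> B +>\<^bsub>V\<^esub> x" for y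
    using that sub.scale_mem[of "y - x" c]
    unfolding coset_eq_iff by (simp add: coset_eq scale_right_diff_distrib)
  then have const: "\<forall>y\<in>B +>\<^bsub>V\<^esub> x. B +>\<^bsub>V\<^esub> scale c y = B +>\<^bsub>V\<^esub> scale c x"
    by blast
  \<comment> \<open>The coset must be nonempty: otherwise the union would be empty instead of the
    common value.\<close>
  have "x \<in> B +>\<^bsub>V\<^esub> x" by (simp add: coset_eq sub.zero_mem)
  then have "(\<Union>y\<in>B +>\<^bsub>V\<^esub> x. B +>\<^bsub>V\<^esub> scale c y) = B +>\<^bsub>V\<^esub> scale c x"
    using const by (rule UN_constant_eq)
  then show ?thesis by (simp only: quotient_vs_def module.simps subspace_vs_simps)
qed

lemma vectorspace_quotient_vs: "vectorspace class_ring (quotient_vs V B)"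
proof -
  \<comment> \<open>The zero of the quotient is given as \<open>B\<close> and not as the coset of 0,
    so the group axioms that mention it need these three facts.\<close>
  have neg: "\<exists>y\<in>U. B +>\<^bsub>V\<^esub> (x + y) = B" if "x \<in> U" for x
    using that by (intro bexI[of _ "- x"]) (auto simp: coset_zero neg_mem)
  have zero: "B \<in> (\<lambda>x. B +>\<^bsub>V\<^esub> x) ` U"
    using zero_mem coset_zero by force
  have zero_add: "B <+>\<^bsub>V\<^esub> (B +>\<^bsub>V\<^esub> x) = B +>\<^bsub>V\<^esub> x" for x
    using coset_add[of 0 x] by (simp add: coset_zero)
  have "abelian_group (quotient_vs V B)"
    by (rule abelian_groupI)
      (auto simp: coset_add add_mem zero zero_add neg ac_simps)
  then have "module class_ring (quotient_vs V B)"
    by (intro moduleI class_cring.is_cring)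
      (auto simp: coset_add quotient_smult scale_mem scale_left_distrib scale_right_distrib)
  then show ?thesis
    by (intro vectorspace.intro class_field)
qed

end

section \<open>Linear maps between carrier-based spaces, and spaces of functions\<close>

lemma linear_map_class_ringI:
  assumes "vectorspace class_ring V" "vectorspace class_ring W"
    and "\<And>x. x \<in> carrier V \<Longrightarrow> T x \<in> carrier W"
    and "\<And>x y. x \<in> carrier V \<Longrightarrow> y \<in> carrier V \<Longrightarrow> T (x \<oplus>\<^bsub>V\<^esub> y) = T x \<oplus>\<^bsub>W\<^esub> T y"
    and "\<And>c x. x \<in> carrier V \<Longrightarrow> T (c \<odot>\<^bsub>V\<^esub> x) = c \<odot>\<^bsub>W\<^esub> T x"
  shows "linear_map class_ring V W T"
proof -
  have "T \<in> LinearCombinations.module_hom class_ring V W"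
    using assms(3-5) by (simp add: LinearCombinations.module_hom_def)
  with assms(1,2) show ?thesis
    by (intro linear_map.intro mod_hom.intro mod_hom_axioms.intro) (simp_all add: vectorspace_def)
qed

lemma linear_map_im:
  "linear_map K V W T \<Longrightarrow> mod_hom.im V T = T ` carrier V"
  unfolding linear_map_def by (blast dest: mod_hom.im_def)

lemma linear_map_ker:
  "linear_map K V W T \<Longrightarrow> mod_hom.ker V W T = {v \<in> carrier V. T v = \<zero>\<^bsub>W\<^esub>}"
  unfolding linear_map_def by (blast dest: mod_hom.ker_def)

lemma vector_space_fun_scl: "vector_space s \<Longrightarrow> vector_space (fun_scl s)"
  by (auto simp: vector_space_def fun_scl_def fun_eq_iff)

lemma vector_space_pair_scl:
  "vector_space s \<Longrightarrow> vector_space t \<Longrightarrow> vector_space (pair_scl s t)"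
  by (auto simp: vector_space_def pair_scl_def prod_eq_iff)

lemma linear_fun_add:
  assumes "Vector_Spaces.linear s1 s2 f" "Vector_Spaces.linear s1 s2 g"
  shows "Vector_Spaces.linear s1 s2 (f + g)"
proof -
  interpret f: Vector_Spaces.linear s1 s2 f by fact
  interpret g: Vector_Spaces.linear s1 s2 g by fact
  show ?thesis
    by unfold_locales
      (simp_all add: f.add g.add f.scale g.scale f.vs2.scale_right_distrib ac_simps)
qed

lemma linear_fun_scl:
  assumes "Vector_Spaces.linear s1 s2 f"
  shows "Vector_Spaces.linear s1 s2 (fun_scl s2 c f)"
proof -
  interpret f: Vector_Spaces.linear s1 s2 f by fact
  show ?thesis
    by unfold_locales
      (simp_all add: fun_scl_def f.add f.scale f.vs2.scale_right_distrib mult.commute)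
qed

lemma linear_fun_0:
  assumes "vector_space s1" "vector_space s2"
  shows "Vector_Spaces.linear s1 s2 0"
proof -
  interpret v1: vector_space s1 by fact
  interpret v2: vector_space s2 by fact
  show ?thesis by unfold_locales simp_all
qed

section \<open>Cochains of a representation\<close>

lemma bilinear_mapI:
  assumes "vector_space sX" "vector_space sY" "vector_space sZ"
    and "\<And>x x' y. B (x + x') y = B x y + B x' y" "\<And>c x y. B (sX c x) y = sZ c (B x y)"
    and "\<And>x y y'. B x (y + y') = B x y + B x y'" "\<And>c x y. B x (sY c y) = sZ c (B x y)"
  shows "bilinear_map sX sY sZ B"
  using assms by (simp add: bilinear_map_def Vector_Spaces.linear_iff)

section \<open>Derivations of an algebra with bracket\<close>

context awb_algebra
begin

lemmas bilinear_simps = bilinear_mapD[OF bilinear_mul] bilinear_mapD[OF bilinear_br]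

lemma Der_0: "0 \<in> Der_AWB A"
  by (simp add: Der_AWB_def linear_fun_0 vector_space_axioms bilinear_simps)

lemma Der_add:
  assumes "d \<in> Der_AWB A" "d' \<in> Der_AWB A"
  shows "d + d' \<in> Der_AWB A"
  using assms by (simp add: Der_AWB_def linear_fun_add bilinear_simps ac_simps)

lemma Der_fun_scl:
  assumes "d \<in> Der_AWB A"
  shows "fun_scl (scl A) c d \<in> Der_AWB A"
  using assms linear_fun_scl[of "scl A" "scl A" d c]
  by (simp add: Der_AWB_def fun_scl_def bilinear_simps scale_right_distrib)

lemma Der_linear: "d \<in> Der_AWB A \<Longrightarrow> Vector_Spaces.linear (scl A) (scl A) d"
  by (simp add: Der_AWB_def)

lemma Der_simps:
  assumes "d \<in> Der_AWB A"
  shows "d (mul A x y) = mul A x (d y) + mul A (d x) y"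
    and "d (br A x y) = br A x (d y) + br A (d x) y"
  using assms by (simp_all add: Der_AWB_def)

end

text \<open>With zero product and bracket, both Leibniz rules shrink to \<open>d 0 = 0\<close>,
  which linearity gives. This is the identification of the derivations of \<open>M\<close> with its
  endomorphisms.\<close>

lemma Der_abelian_awb:
  "d \<in> Der_AWB (abelian_awb s) \<longleftrightarrow> Vector_Spaces.linear s s d"
  by (auto simp: Der_AWB_def abelian_awb_def linearD(4))

section \<open>Cocycle conditions, coboundaries and the action of derivation pairs on
  cochains\<close>

context awb_representation
begin

lemmas bilinear_simps = alg.bilinear_simps
  bilinear_mapD[OF bilinear_lact] bilinear_mapD[OF bilinear_ract]
  bilinear_mapD[OF bilinear_lbr] bilinear_mapD[OF bilinear_rbr]

definition assoc_defect :: "('a \<Rightarrow> 'a \<Rightarrow> 'm) \<Rightarrow> 'a \<Rightarrow> 'a \<Rightarrow> 'a \<Rightarrow> 'm" where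
  "assoc_defect f a0 a1 a2 =
     lact M a0 (f a1 a2) - f (mul A a0 a1) a2 + f a0 (mul A a1 a2) - ract M (f a0 a1) a2"

text \<open>As a difference of two sides, the second cocycle condition becomes a trilinear
  expression for bilinear \<open>f\<close> and \<open>g\<close>, to which derivations can be
  applied; \<open>assoc_defect\<close> does the same for the first.\<close>

definition leibniz_defect ::
  "('a \<Rightarrow> 'a \<Rightarrow> 'm) \<Rightarrow> ('a \<Rightarrow> 'a \<Rightarrow> 'm) \<Rightarrow> 'a \<Rightarrow> 'a \<Rightarrow> 'a \<Rightarrow> 'm" where
  "leibniz_defect f g a0 a1 a2 =
     lact M a0 (g a1 a2) + ract M (g a0 a2) a1 - g (mul A a0 a1) a2
     - (rbr M (f a0 a1) a2 - f (br A a0 a2) a1 - f a0 (br A a1 a2))"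

lemma cocycles0_iff:
  "(f, g) \<in> carrier (cocycles0 A M) \<longleftrightarrow>
     bilinear_map (scl A) (scl A) (rscl M) f \<and> bilinear_map (scl A) (scl A) (rscl M) g \<and>
     (\<forall>a0 a1 a2. assoc_defect f a0 a1 a2 = 0) \<and> (\<forall>a0 a1 a2. leibniz_defect f g a0 a1 a2 = 0)"
  by (simp add: cocycles0_def assoc_defect_def leibniz_defect_def)

lemma bilinear_map_AM_I:
  assumes "\<And>x x' y. B (x + x') y = B x y + B x' y" "\<And>c x y. B (scl A c x) y = rscl M c (B x y)"
    and "\<And>x y y'. B x (y + y') = B x y + B x y'" "\<And>c x y. B x (scl A c y) = rscl M c (B x y)"
  shows "bilinear_map (scl A) (scl A) (rscl M) B"
  by (intro bilinear_mapI alg.vector_space_axioms rep.vector_space_axioms assms)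

lemma bilinear_0: "bilinear_map (scl A) (scl A) (rscl M) 0"
  by (rule bilinear_map_AM_I) simp_all

lemma bilinear_add:
  assumes "bilinear_map (scl A) (scl A) (rscl M) f" "bilinear_map (scl A) (scl A) (rscl M) g"
  shows "bilinear_map (scl A) (scl A) (rscl M) (f + g)"
  by (rule bilinear_map_AM_I)
    (simp_all add: bilinear_mapD[OF assms(1)] bilinear_mapD[OF assms(2)] rep.scale_right_distrib
      ac_simps)

lemma bilinear_fun_scl:
  assumes "bilinear_map (scl A) (scl A) (rscl M) f"
  shows "bilinear_map (scl A) (scl A) (rscl M) (fun_scl (fun_scl (rscl M)) c f)"
  by (rule bilinear_map_AM_I)
    (simp_all add: fun_scl_def bilinear_mapD[OF assms] rep.scale_right_distrib mult.commute)

lemma D_AWB_iff: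
  "(dM, dA) \<in> carrier (D_AWB A M) \<longleftrightarrow>
     Vector_Spaces.linear (rscl M) (rscl M) dM \<and> dA \<in> Der_AWB A \<and>
     (\<forall>a m. dM (lact M a m) = lact M a (dM m) + lact M (dA a) m) \<and>
     (\<forall>a m. dM (ract M m a) = ract M m (dA a) + ract M (dM m) a) \<and>
     (\<forall>a m. dM (lbr M a m) = lbr M a (dM m) + lbr M (dA a) m) \<and>
     (\<forall>a m. dM (rbr M m a) = rbr M m (dA a) + rbr M (dM m) a)"
  by (simp add: D_AWB_def Der_abelian_awb)

lemma D_AWB_simps:
  assumes "(dM, dA) \<in> carrier (D_AWB A M)"
  shows "dM (x + y) = dM x + dM y" "dM (x - y) = dM x - dM y" "dM (- x) = - dM x" "dM 0 = 0"
    "dM (rscl M c x) = rscl M c (dM x)"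
    and "dA (a + b) = dA a + dA b" "dA (a - b) = dA a - dA b" "dA (- a) = - dA a" "dA 0 = 0"
    "dA (scl A c a) = scl A c (dA a)"
    and "dA (mul A a b) = mul A a (dA b) + mul A (dA a) b"
    "dA (br A a b) = br A a (dA b) + br A (dA a) b"
    and "dM (lact M a m) = lact M a (dM m) + lact M (dA a) m"
    "dM (ract M m a) = ract M m (dA a) + ract M (dM m) a"
    "dM (lbr M a m) = lbr M a (dM m) + lbr M (dA a) m"
    "dM (rbr M m a) = rbr M m (dA a) + rbr M (dM m) a"
proof -
  have dM: "Vector_Spaces.linear (rscl M) (rscl M) dM" and dA: "dA \<in> Der_AWB A"
    using assms by (simp_all add: D_AWB_iff)
  show "dM (x + y) = dM x + dM y" "dM (x - y) = dM x - dM y" "dM (- x) = - dM x" "dM 0 = 0"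
    "dM (rscl M c x) = rscl M c (dM x)"
    by (fact linearD[OF dM])+
  show "dA (a + b) = dA a + dA b" "dA (a - b) = dA a - dA b" "dA (- a) = - dA a" "dA 0 = 0"
    "dA (scl A c a) = scl A c (dA a)"
    by (fact linearD[OF alg.Der_linear[OF dA]])+
  show "dA (mul A a b) = mul A a (dA b) + mul A (dA a) b"
    "dA (br A a b) = br A a (dA b) + br A (dA a) b"
    by (fact alg.Der_simps[OF dA])+
  show "dM (lact M a m) = lact M a (dM m) + lact M (dA a) m"
    "dM (ract M m a) = ract M m (dA a) + ract M (dM m) a"
    "dM (lbr M a m) = lbr M a (dM m) + lbr M (dA a) m"
    "dM (rbr M m a) = rbr M m (dA a) + rbr M (dM m) a"
    using assms by (simp_all add: D_AWB_iff)
qed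

lemma defect_0: "assoc_defect 0 a0 a1 a2 = 0" "leibniz_defect 0 0 a0 a1 a2 = 0"
  by (simp_all add: assoc_defect_def leibniz_defect_def bilinear_simps)

lemma defect_add:
  "assoc_defect (f + f') a0 a1 a2 = assoc_defect f a0 a1 a2 + assoc_defect f' a0 a1 a2"
  "leibniz_defect (f + f') (g + g') a0 a1 a2
     = leibniz_defect f g a0 a1 a2 + leibniz_defect f' g' a0 a1 a2"
  by (simp_all add: assoc_defect_def leibniz_defect_def bilinear_simps algebra_simps)

lemma defect_fun_scl:
  "assoc_defect (fun_scl (fun_scl (rscl M)) c f) a0 a1 a2 = rscl M c (assoc_defect f a0 a1 a2)"
  "leibniz_defect (fun_scl (fun_scl (rscl M)) c f) (fun_scl (fun_scl (rscl M)) c g) a0 a1 a2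
     = rscl M c (leibniz_defect f g a0 a1 a2)"
  by (simp_all add: assoc_defect_def leibniz_defect_def fun_scl_def bilinear_simps
      rep.scale_right_distrib rep.scale_right_diff_distrib)

text \<open>\<open>theta\<close> is the natural action of a pair \<open>(dM, dA)\<close> on bilinear
  maps, and the right-hand side is the same action on trilinear maps. The defect commutes with it
  because the pair satisfies a Leibniz rule for every operation in the defect.\<close>

lemma assoc_defect_theta:
  assumes D: "(dM, dA) \<in> carrier (D_AWB A M)"
    and f: "bilinear_map (scl A) (scl A) (rscl M) f"
  shows "assoc_defect (theta dM dA f) a0 a1 a2
      = dM (assoc_defect f a0 a1 a2) - assoc_defect f (dA a0) a1 a2
        - assoc_defect f a0 (dA a1) a2 - assoc_defect f a0 a1 (dA a2)"
  by (simp add: assoc_defect_def theta_def D_AWB_simps[OF D] bilinear_simps bilinear_mapD[OF f]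
      algebra_simps)

lemma leibniz_defect_theta:
  assumes D: "(dM, dA) \<in> carrier (D_AWB A M)"
    and f: "bilinear_map (scl A) (scl A) (rscl M) f"
    and g: "bilinear_map (scl A) (scl A) (rscl M) g"
  shows "leibniz_defect (theta dM dA f) (theta dM dA g) a0 a1 a2
      = dM (leibniz_defect f g a0 a1 a2) - leibniz_defect f g (dA a0) a1 a2
        - leibniz_defect f g a0 (dA a1) a2 - leibniz_defect f g a0 a1 (dA a2)"
  by (simp add: leibniz_defect_def theta_def D_AWB_simps[OF D] bilinear_simps bilinear_mapD[OF f]
      bilinear_mapD[OF g] algebra_simps)

lemma bilinear_theta:
  assumes D: "(dM, dA) \<in> carrier (D_AWB A M)"
    and f: "bilinear_map (scl A) (scl A) (rscl M) f"
  shows "bilinear_map (scl A) (scl A) (rscl M) (theta dM dA f)"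
  by (rule bilinear_map_AM_I)
    (simp_all add: theta_def D_AWB_simps[OF D] bilinear_mapD[OF f] rep.scale_right_diff_distrib
      algebra_simps)

text \<open>All defects of \<open>f\<close> and \<open>g\<close> vanish, so the equivariance
  formulas express the defects of the new pair by zeros.\<close>

lemma theta_cocycle:
  assumes D: "(dM, dA) \<in> carrier (D_AWB A M)" and "(f, g) \<in> carrier (cocycles0 A M)"
  shows "(theta dM dA f, theta dM dA g) \<in> carrier (cocycles0 A M)"
  using assms(2)
  by (auto simp: cocycles0_iff bilinear_theta[OF D] assoc_defect_theta[OF D]
      leibniz_defect_theta[OF D] D_AWB_simps[OF D])

lemma coboundary_0: "coboundary A M 0 = 0"
  by (simp add: coboundary_def bilinear_simps zero_prod_def zero_fun_def)

lemma coboundary_add: "coboundary A M (h + h') = coboundary A M h + coboundary A M h'"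
  by (simp add: coboundary_def bilinear_simps plus_prod_def fun_eq_iff algebra_simps)

lemma coboundary_fun_scl:
  "coboundary A M (fun_scl (rscl M) c h)
     = pair_scl (fun_scl (fun_scl (rscl M))) (fun_scl (fun_scl (rscl M))) c (coboundary A M h)"
  by (simp add: coboundary_def fun_scl_def pair_scl_def bilinear_simps
      rep.scale_right_distrib rep.scale_right_diff_distrib)

text \<open>The composite of two consecutive differentials is zero: after expansion, the axioms of
  \<open>A\<close> and of the representation cancel every term.\<close>

lemma coboundary_cocycle:
  assumes "Vector_Spaces.linear (scl A) (rscl M) h"
  shows "coboundary A M h \<in> carrier (cocycles0 A M)"
proof -
  note simps = linearD[OF assms] bilinear_simps rep.scale_right_distrib rep.scale_right_diff_distrib
    alg.mul_assoc alg.br_mul lact_mul ract_mul lact_ract rbr_lact rbr_ract lbr_mul algebra_simps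
  obtain f g where fg: "coboundary A M h = (f, g)" by fastforce
  then have f: "f = (\<lambda>a0 a1. - lact M a0 (h a1) + h (mul A a0 a1) - ract M (h a0) a1)"
    and g: "g = (\<lambda>a0 a1. - lbr M a0 (h a1) + h (br A a0 a1) - rbr M (h a0) a1)"
    by (simp_all add: coboundary_def)
  have "bilinear_map (scl A) (scl A) (rscl M) f" "bilinear_map (scl A) (scl A) (rscl M) g"
    unfolding f g by (rule bilinear_map_AM_I; simp add: simps)+
  moreover have "assoc_defect f a0 a1 a2 = 0" "leibniz_defect f g a0 a1 a2 = 0" for a0 a1 a2
    unfolding f g assoc_defect_def leibniz_defect_def by (simp_all add: simps)
  ultimately show ?thesis
    unfolding fg cocycles0_iff by blast
qed

lemma coboundaries0I:
  "Vector_Spaces.linear (scl A) (rscl M) h \<Longrightarrow> coboundary A M h = c \<Longrightarrow> c \<in> coboundaries0 A M"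
  by (auto simp: coboundaries0_def)

text \<open>The action of a derivation pair commutes with the coboundary and hence passes to
  cohomology classes. This is what makes the Wells class independent of the section.\<close>

lemma theta_coboundary:
  assumes D: "(dM, dA) \<in> carrier (D_AWB A M)" and "(f, g) \<in> coboundaries0 A M"
  shows "(theta dM dA f, theta dM dA g) \<in> coboundaries0 A M"
proof -
  obtain h where h: "Vector_Spaces.linear (scl A) (rscl M) h" and fg: "(f, g) = coboundary A M h"
    using assms(2) by (auto simp: coboundaries0_def)
  \<comment> \<open>The action of \<open>(dM, dA)\<close> on the (-1)-cochain
    \<open>h\<close>.\<close>
  define h' where "h' a = dM (h a) - h (dA a)" for a
  have "Vector_Spaces.linear (scl A) (rscl M) h'"
    unfolding Vector_Spaces.linear_iff h'_def
    by (simp add: D_AWB_simps[OF D] linearD[OF h] rep.scale_right_diff_distrib algebra_simps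
        alg.vector_space_axioms rep.vector_space_axioms)
  moreover have "theta dM dA f a0 a1 = fst (coboundary A M h') a0 a1"
    and "theta dM dA g a0 a1 = snd (coboundary A M h') a0 a1" for a0 a1
    using fg
    by (simp_all add: coboundary_def theta_def h'_def D_AWB_simps[OF D] linearD[OF h]
        bilinear_simps algebra_simps)
  then have "(theta dM dA f, theta dM dA g) = coboundary A M h'"
    by (simp add: prod_eq_iff fun_eq_iff)
  ultimately show ?thesis by (simp add: coboundaries0I)
qed

section \<open>Vector space structure on the spaces of the sequence\<close>

abbreviation cochain_scl where
  "cochain_scl \<equiv> pair_scl (fun_scl (fun_scl (rscl M))) (fun_scl (fun_scl (rscl M)))"

lemma vector_space_cochains: "vector_space cochain_scl"
  by (intro vector_space_pair_scl vector_space_fun_scl rep.vector_space_axioms)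

lemma cochain_scl_0: "cochain_scl c 0 = 0"
  by (simp add: pair_scl_def fun_scl_def zero_prod_def zero_fun_def)

lemma linear_subspace_cocycles0: "linear_subspace cochain_scl (carrier (cocycles0 A M))"
proof (intro linear_subspace.intro linear_subspace_axioms.intro vector_space_cochains)
  show "0 \<in> carrier (cocycles0 A M)"
    by (simp add: zero_prod_def cocycles0_iff bilinear_0 defect_0)
next
  fix x y
  assume "x \<in> carrier (cocycles0 A M)" "y \<in> carrier (cocycles0 A M)"
  then show "x + y \<in> carrier (cocycles0 A M)"
    by (cases x; cases y) (simp add: cocycles0_iff bilinear_add defect_add)
next
  fix x c
  assume "x \<in> carrier (cocycles0 A M)"
  then show "cochain_scl c x \<in> carrier (cocycles0 A M)"
    by (cases x) (simp add: pair_scl_def cocycles0_iff bilinear_fun_scl defect_fun_scl)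
qed

lemma linear_subspace_coboundaries0: "linear_subspace cochain_scl (coboundaries0 A M)"
proof (intro linear_subspace.intro linear_subspace_axioms.intro vector_space_cochains)
  show "0 \<in> coboundaries0 A M"
    unfolding coboundaries0_def
    using linear_fun_0[OF alg.vector_space_axioms rep.vector_space_axioms]
    by (intro image_eqI[of _ _ 0]) (simp_all add: coboundary_0)
next
  fix x y
  assume "x \<in> coboundaries0 A M" "y \<in> coboundaries0 A M"
  then show "x + y \<in> coboundaries0 A M"
    unfolding coboundaries0_def by (auto simp flip: coboundary_add intro!: imageI linear_fun_add)
next
  fix x c
  assume "x \<in> coboundaries0 A M"
  then show "cochain_scl c x \<in> coboundaries0 A M"
    unfolding coboundaries0_def by (auto simp flip: coboundary_fun_scl intro!: imageI linear_fun_scl)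
qed

lemma linear_subspace_cocycles_neg1: "linear_subspace (fun_scl (rscl M)) (carrier (cocycles_neg1 A M))"
  using linear_fun_0[OF alg.vector_space_axioms rep.vector_space_axioms] cochain_scl_0
  by (intro linear_subspace.intro linear_subspace_axioms.intro vector_space_fun_scl
      rep.vector_space_axioms)
    (auto simp: cocycles_neg1_def coboundary_0 coboundary_add coboundary_fun_scl linear_fun_add
      linear_fun_scl)

lemma linear_subspace_D_AWB:
  "linear_subspace (pair_scl (fun_scl (rscl M)) (fun_scl (scl A))) (carrier (D_AWB A M))"
proof (intro linear_subspace.intro linear_subspace_axioms.intro vector_space_pair_scl
    vector_space_fun_scl
    rep.vector_space_axioms alg.vector_space_axioms)
  show "0 \<in> carrier (D_AWB A M)"
    using linear_fun_0[OF rep.vector_space_axioms rep.vector_space_axioms] alg.Der_0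
    by (simp add: zero_prod_def D_AWB_iff bilinear_simps)
next
  fix x y
  assume "x \<in> carrier (D_AWB A M)" "y \<in> carrier (D_AWB A M)"
  then show "x + y \<in> carrier (D_AWB A M)"
    by (cases x; cases y)
      (simp add: D_AWB_iff linear_fun_add alg.Der_add bilinear_simps algebra_simps)
next
  fix x c
  assume x: "x \<in> carrier (D_AWB A M)"
  obtain dM dA where "x = (dM, dA)" by fastforce
  with x have "Vector_Spaces.linear (rscl M) (rscl M) (fun_scl (rscl M) c dM)"
    "fun_scl (scl A) c dA \<in> Der_AWB A"
    and D: "(dM, dA) \<in> carrier (D_AWB A M)"
    by (simp_all add: D_AWB_iff linear_fun_scl alg.Der_fun_scl)
  then show "pair_scl (fun_scl (rscl M)) (fun_scl (scl A)) c x \<in> carrier (D_AWB A M)"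
    by (simp add: \<open>x = _\<close> pair_scl_def D_AWB_iff)
      (simp add: fun_scl_def D_AWB_simps[OF D] bilinear_simps rep.scale_right_distrib)
qed

lemma vectorspace_D_AWB: "vectorspace class_ring (D_AWB A M)"
  using linear_subspace.vectorspace_subspace_vs[OF linear_subspace_D_AWB] by (simp add: D_AWB_def)

lemma vectorspace_cocycles_neg1: "vectorspace class_ring (cocycles_neg1 A M)"
  using linear_subspace.vectorspace_subspace_vs[OF linear_subspace_cocycles_neg1]
  by (simp add: cocycles_neg1_def)

text \<open>The rewrite states the coset facts for \<open>cocycles0 A M\<close> itself, the record
  in which \<open>cl\<close> and \<open>H1_AWB\<close> form their cosets.\<close>

sublocale H1: subspace_quotient cochain_scl "carrier (cocycles0 A M)" "coboundaries0 A M"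
  rewrites "subspace_vs cochain_scl (carrier (cocycles0 A M)) = cocycles0 A M"
proof -
  show "subspace_quotient cochain_scl (carrier (cocycles0 A M)) (coboundaries0 A M)"
    using coboundary_cocycle
    by (intro subspace_quotient.intro subspace_quotient_axioms.intro linear_subspace_cocycles0
        linear_subspace_coboundaries0) (auto simp: coboundaries0_def)
  show "subspace_vs cochain_scl (carrier (cocycles0 A M)) = cocycles0 A M"
    by (simp add: cocycles0_def)
qed

lemma vectorspace_H1: "vectorspace class_ring (H1_AWB A M)"
  using H1.vectorspace_quotient_vs by (simp add: H1_AWB_def)

lemma cl_eq_iff: "cl A M x = cl A M y \<longleftrightarrow> x - y \<in> coboundaries0 A M"
  by (simp add: cl_def H1.coset_eq_iff)

text \<open>With these rules, computations in the cohomology space are carried out on representing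
  cocycles.\<close>

lemma H1_simps:
  "carrier (H1_AWB A M) = cl A M ` carrier (cocycles0 A M)"
  "cl A M x \<oplus>\<^bsub>H1_AWB A M\<^esub> cl A M y = cl A M (x + y)"
  "c \<odot>\<^bsub>H1_AWB A M\<^esub> cl A M x = cl A M (cochain_scl c x)"
  "cl A M x = \<zero>\<^bsub>H1_AWB A M\<^esub> \<longleftrightarrow> x \<in> coboundaries0 A M"
  by (simp_all add: H1_AWB_def cl_def H1.coset_add H1.quotient_smult H1.coset_eq_zero_iff)

end

section \<open>Derivations of an extension\<close>

context abelian_extension
begin

lemma linear_i: "Vector_Spaces.linear (rscl M) (scl E) i"
  using hom_i by (simp add: awb_hom_def abelian_awb_def)

lemma linear_p: "Vector_Spaces.linear (scl E) (scl A) p"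
  using hom_p by (simp add: awb_hom_def)

lemmas i_simps = linearD[OF linear_i]
lemmas p_simps = linearD[OF linear_p]

lemma p_mul: "p (mul E x y) = mul A (p x) (p y)"
  and p_br: "p (br E x y) = br A (p x) (p y)"
  using hom_p by (simp_all add: awb_hom_def)

lemma mul_i_i: "mul E (i m) (i n) = 0"
  and br_i_i: "br E (i m) (i n) = 0"
  using hom_i by (simp_all add: awb_hom_def abelian_awb_def i_simps)

lemma p_i [simp]: "p (i m) = 0"
  using exact_at_E by auto

lemma i_eq_iff [simp]: "i m = i n \<longleftrightarrow> m = n"
  using inj_i by (simp add: inj_eq)

lemma inv_i_i [simp]: "inv_into UNIV i (i m) = m"
  using inj_i by simp

lemma i_inv_i: "p e = 0 \<Longrightarrow> i (inv_into UNIV i e) = e"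
  using exact_at_E by (auto intro!: f_inv_into_f)

lemmas induced = induced_lact induced_ract induced_lbr induced_rbr

text \<open>Over a field, a surjective linear map has a linear right inverse.\<close>

lemma ex_linear_section: "\<exists>s. linear_section A E p s"
proof -
  interpret pair: vector_space_pair "scl E" "scl A"
    by (intro vector_space_pair.intro ext.vector_space_axioms rep.alg.vector_space_axioms)
  show ?thesis
    using pair.linear_surjective_right_inverse[OF linear_p surj_p]
    by (auto simp: linear_section_def fun_eq_iff)
qed

text \<open>Since the image of \<open>i\<close> is the kernel of \<open>p\<close>, stability of
  \<open>M\<close> under \<open>d\<close> can be tested by an equation.\<close>

lemma Der_rel_iff:
  "d \<in> carrier (Der_rel E i) \<longleftrightarrow> d \<in> Der_AWB E \<and> (\<forall>m. p (d (i m)) = 0)"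
proof -
  have "e \<in> range i \<longleftrightarrow> p e = 0" for e
    using exact_at_E by blast
  then show ?thesis by (auto simp: Der_rel_def image_subset_iff)
qed

lemma linear_subspace_Der_rel: "linear_subspace (fun_scl (scl E)) (carrier (Der_rel E i))"
  by (intro linear_subspace.intro linear_subspace_axioms.intro vector_space_fun_scl
      ext.vector_space_axioms)
    (auto simp: Der_rel_iff ext.Der_0 ext.Der_add ext.Der_fun_scl p_simps,
      simp add: fun_scl_def p_simps)

lemma vectorspace_Der_rel: "vectorspace class_ring (Der_rel E i)"
  using linear_subspace.vectorspace_subspace_vs[OF linear_subspace_Der_rel] by (simp add: Der_rel_def)

end

section \<open>A fixed linear section and its factor set\<close>

locale extension_section = abelian_extension A M E i p
  for A :: "('k::field, 'a::ab_group_add) awb"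
  and M :: "('k, 'a, 'm::ab_group_add) awb_rep"
  and E :: "('k, 'e::ab_group_add) awb"
  and i :: "'m \<Rightarrow> 'e"
  and p :: "'e \<Rightarrow> 'a" +
  fixes s :: "'a \<Rightarrow> 'e"
  assumes is_section: "linear_section A E p s"
begin

lemma linear_s: "Vector_Spaces.linear (scl A) (scl E) s"
  using is_section by (simp add: linear_section_def)

lemma p_s [simp]: "p (s a) = a"
  using is_section by (simp add: linear_section_def)

lemmas s_simps = linearD[OF linear_s]

definition factor_mul where "factor_mul = fst (section_cocycle A E i s)"
definition factor_br where "factor_br = snd (section_cocycle A E i s)"

lemma section_cocycle_eq: "section_cocycle A E i s = (factor_mul, factor_br)"
  by (simp add: factor_mul_def factor_br_def)

text \<open>\<open>p\<close> kills the right-hand side, so it lies in the image of \<open>i\<close>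
  and the inverse in \<open>section_cocycle\<close> is a genuine preimage.\<close>

lemma i_factor_mul: "i (factor_mul a b) = mul E (s a) (s b) - s (mul A a b)"
  by (simp add: factor_mul_def section_cocycle_def i_inv_i p_simps p_mul)

lemma i_factor_br: "i (factor_br a b) = br E (s a) (s b) - s (br A a b)"
  by (simp add: factor_br_def section_cocycle_def i_inv_i p_simps p_br)

lemma i_act:
  "i (lact M a m) = mul E (s a) (i m)" "i (ract M m a) = mul E (i m) (s a)"
  "i (lbr M a m) = br E (s a) (i m)" "i (rbr M m a) = br E (i m) (s a)"
  using induced_lact[of "s a"] induced_ract[of _ "s a"] induced_lbr[of "s a"] induced_rbr[of _ "s a"]
  by simp_all

text \<open>Each identity is pushed into \<open>E\<close> by the injective map \<open>i\<close>.
  There the first cocycle condition follows from associativity, and the second from the rule for the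
  bracket of a product.\<close>

lemma section_cocycle_cocycle: "(factor_mul, factor_br) \<in> carrier (cocycles0 A M)"
proof -
  have "bilinear_map (scl A) (scl A) (rscl M) factor_mul"
    by (rule rep.bilinear_map_AM_I; subst i_eq_iff[symmetric])
      (simp_all add: i_simps i_factor_mul s_simps rep.alg.bilinear_simps ext.bilinear_simps
        ext.scale_right_diff_distrib)
  moreover have "bilinear_map (scl A) (scl A) (rscl M) factor_br"
    by (rule rep.bilinear_map_AM_I; subst i_eq_iff[symmetric])
      (simp_all add: i_simps i_factor_br s_simps rep.alg.bilinear_simps ext.bilinear_simps
        ext.scale_right_diff_distrib)
  moreover have "rep.assoc_defect factor_mul a0 a1 a2 = 0" for a0 a1 a2
    unfolding rep.assoc_defect_def i_eq_iff[symmetric]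
    by (simp add: i_simps i_act i_factor_mul ext.bilinear_simps ext.mul_assoc rep.alg.mul_assoc)
  moreover have "rep.leibniz_defect factor_mul factor_br a0 a1 a2 = 0" for a0 a1 a2
    unfolding rep.leibniz_defect_def i_eq_iff[symmetric]
    by (simp add: i_simps i_act i_factor_mul i_factor_br s_simps ext.bilinear_simps ext.br_mul
        rep.alg.br_mul algebra_simps)
  ultimately show ?thesis by (simp add: rep.cocycles0_iff)
qed

text \<open>Moves a coboundary equation into \<open>E\<close>. The function \<open>u\<close> is left
  free because in applications \<open>h\<close> is a preimage under \<open>i\<close> of an explicit
  map, which then takes the place of \<open>i (h a)\<close>.\<close>

lemma coboundary_eq_iff:
  assumes "\<And>a. i (h a) = u a"
  shows "coboundary A M h = (b, c) \<longleftrightarrow>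
    (\<forall>x y. i (b x y) = u (mul A x y) - mul E (s x) (u y) - mul E (u x) (s y)) \<and>
    (\<forall>x y. i (c x y) = u (br A x y) - br E (s x) (u y) - br E (u x) (s y))"
proof -
  have "coboundary A M h = (b, c) \<longleftrightarrow>
    (\<forall>x y. i (b x y) = i (fst (coboundary A M h) x y)) \<and>
    (\<forall>x y. i (c x y) = i (snd (coboundary A M h) x y))"
    by (auto simp: prod_eq_iff fun_eq_iff)
  then show ?thesis
    by (simp add: coboundary_def i_simps i_act assms algebra_simps)
qed

section \<open>The linear splitting of \<open>E\<close> and the map \<open>kappa_via\<close>\<close>

lemma decompose: obtains a m where "e = s a + i m"
proof -
  have "i (inv_into UNIV i (e - s (p e))) = e - s (p e)"
    by (rule i_inv_i) (simp add: p_simps)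
  then show ?thesis by (intro that[of "p e" "inv_into UNIV i (e - s (p e))"]) simp
qed

text \<open>A description of \<open>kappa_via\<close> that does not mention the section: as
  \<open>d\<close> preserves \<open>M\<close>, the map \<open>p \<circ> d\<close> vanishes on
  \<open>M\<close> and factors through \<open>p\<close>.\<close>

lemma kappa_via_eq_iff:
  assumes d: "d \<in> carrier (Der_rel E i)"
  shows "kappa_via i p s d = (dM, dA) \<longleftrightarrow>
    (\<forall>m. d (i m) = i (dM m)) \<and> (\<forall>e. p (d e) = dA (p e))"
proof -
  have d_M: "p (d (i m)) = 0" for m
    using d by (simp add: Der_rel_iff)
  have lin: "Vector_Spaces.linear (scl E) (scl E) d"
    using d by (simp add: Der_rel_iff ext.Der_linear)
  have "inv_into UNIV i (d (i m)) = dM m \<longleftrightarrow> d (i m) = i (dM m)" for m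
    using i_inv_i[OF d_M] by (metis inv_i_i)
  moreover have "(\<forall>a. p (d (s a)) = dA a) \<longleftrightarrow> (\<forall>e. p (d e) = dA (p e))"
  proof
    assume *: "\<forall>a. p (d (s a)) = dA a"
    show "\<forall>e. p (d e) = dA (p e)"
    proof
      fix e
      obtain a m where "e = s a + i m" by (rule decompose)
      then show "p (d e) = dA (p e)"
        using * by (simp add: linearD[OF lin] p_simps d_M)
    qed
  next
    assume "\<forall>e. p (d e) = dA (p e)"
    then show "\<forall>a. p (d (s a)) = dA a" by simp
  qed
  ultimately show ?thesis
    by (simp add: kappa_via_def fun_eq_iff)
qed

lemma kappa_via_simps:
  assumes "d \<in> carrier (Der_rel E i)"
  shows "i (fst (kappa_via i p s d) m) = d (i m)" "snd (kappa_via i p s d) (p e) = p (d e)"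
  using kappa_via_eq_iff[OF assms, of "fst (kappa_via i p s d)" "snd (kappa_via i p s d)"]
  by simp_all

lemma kappa_via_mem:
  assumes d: "d \<in> carrier (Der_rel E i)"
  shows "kappa_via i p s d \<in> carrier (D_AWB A M)"
proof -
  obtain dM dA where \<kappa>: "kappa_via i p s d = (dM, dA)" by fastforce
  then have dM: "i (dM m) = d (i m)" and dA: "dA (p e) = p (d e)" for m e
    using kappa_via_simps[OF d] by simp_all
  have Der: "d \<in> Der_AWB E" using d by (simp add: Der_rel_iff)
  note simps = linearD[OF ext.Der_linear[OF Der]] ext.Der_simps[OF Der]
  have dA_s: "dA a = p (d (s a))" for a
    using dA[of "s a"] by simp
  have "Vector_Spaces.linear (rscl M) (rscl M) dM"
    unfolding Vector_Spaces.linear_iff i_eq_iff[symmetric]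
    by (simp add: i_simps dM simps rep.rep.vector_space_axioms)
  moreover have "dA \<in> Der_AWB A"
  proof -
    have "Vector_Spaces.linear (scl A) (scl A) dA"
      unfolding Vector_Spaces.linear_iff
      by (simp add: dA_s s_simps simps p_simps rep.alg.vector_space_axioms)
    \<comment> \<open>The Leibniz rules are checked on images under \<open>p\<close>, where they are
      the projected rules of \<open>d\<close>; the section shows that every element of
      \<open>A\<close> is such an image.\<close>
    moreover have "dA (mul A (p x) (p y)) = mul A (p x) (dA (p y)) + mul A (dA (p x)) (p y)"
      and "dA (br A (p x) (p y)) = br A (p x) (dA (p y)) + br A (dA (p x)) (p y)" for x y
      unfolding p_mul[symmetric] p_br[symmetric] dA by (simp_all add: simps p_simps p_mul p_br)
    then have "dA (mul A a b) = mul A a (dA b) + mul A (dA a) b"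
      and "dA (br A a b) = br A a (dA b) + br A (dA a) b" for a b
      using p_s by metis+
    ultimately show ?thesis by (simp add: Der_AWB_def)
  qed
  moreover have
    "dM (lact M a m) = lact M a (dM m) + lact M (dA a) m"
    "dM (ract M m a) = ract M m (dA a) + ract M (dM m) a"
    "dM (lbr M a m) = lbr M a (dM m) + lbr M (dA a) m"
    "dM (rbr M m a) = rbr M m (dA a) + rbr M (dM m) a" for a m
    unfolding i_eq_iff[symmetric] dM i_simps
    \<comment> \<open>The action of \<open>dA a = p (d (s a))\<close> on \<open>M\<close> can be
      computed in \<open>E\<close> with the lift \<open>d (s a)\<close>, so each identity becomes
      the derivation rule for \<open>d\<close> at \<open>s a\<close> and \<open>i m\<close>.\<close>
    by (simp_all add: dA_s induced) (simp_all add: i_act simps dM)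
  ultimately show ?thesis
    by (simp add: \<kappa> rep.D_AWB_iff)
qed

text \<open>By \<open>kappa_via_eq_iff\<close> it suffices that the sum or multiple of the pairs
  describes the sum or multiple of the derivations on \<open>M\<close> and modulo
  \<open>M\<close>.\<close>

lemma linear_map_kappa: "linear_map class_ring (Der_rel E i) (D_AWB A M) (kappa_via i p s)"
proof (rule linear_map_class_ringI[OF vectorspace_Der_rel rep.vectorspace_D_AWB kappa_via_mem])
  fix d d'
  assume d: "d \<in> carrier (Der_rel E i)" and d': "d' \<in> carrier (Der_rel E i)"
  then have "d + d' \<in> carrier (Der_rel E i)"
    by (rule linear_subspace.add_mem[OF linear_subspace_Der_rel])
  moreover have "kappa_via i p s d + kappa_via i p s d'
      = (fst (kappa_via i p s d) + fst (kappa_via i p s d'),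
         snd (kappa_via i p s d) + snd (kappa_via i p s d'))"
    by (simp add: plus_prod_def)
  ultimately have "kappa_via i p s (d + d') = kappa_via i p s d + kappa_via i p s d'"
    by (simp add: kappa_via_eq_iff kappa_via_simps d d' i_simps p_simps)
  then show "kappa_via i p s (d \<oplus>\<^bsub>Der_rel E i\<^esub> d')
      = kappa_via i p s d \<oplus>\<^bsub>D_AWB A M\<^esub> kappa_via i p s d'"
    by (simp add: Der_rel_def D_AWB_def)
next
  fix c d
  assume d: "d \<in> carrier (Der_rel E i)"
  then have "fun_scl (scl E) c d \<in> carrier (Der_rel E i)"
    by (rule linear_subspace.scale_mem[OF linear_subspace_Der_rel])
  then have "kappa_via i p s (fun_scl (scl E) c d)
      = pair_scl (fun_scl (rscl M)) (fun_scl (scl A)) c (kappa_via i p s d)"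
    unfolding pair_scl_def
    by (simp add: kappa_via_eq_iff) (simp add: fun_scl_def kappa_via_simps d i_simps p_simps)
  then show "kappa_via i p s (c \<odot>\<^bsub>Der_rel E i\<^esub> d) = c \<odot>\<^bsub>D_AWB A M\<^esub> kappa_via i p s d"
    by (simp add: Der_rel_def D_AWB_def)
qed (assumption)

section \<open>The map \<open>sigma\<close> and exactness at the derivations of
  \<open>E\<close>\<close>

definition sigma :: "('a \<Rightarrow> 'm) \<Rightarrow> 'e \<Rightarrow> 'e" where
  "sigma h = i \<circ> h \<circ> p"

lemma cocycles_neg1_iff:
  "h \<in> carrier (cocycles_neg1 A M) \<longleftrightarrow> Vector_Spaces.linear (scl A) (rscl M) h \<and>
     (\<forall>a b. h (mul A a b) = lact M a (h b) + ract M (h a) b) \<and>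
     (\<forall>a b. h (br A a b) = lbr M a (h b) + rbr M (h a) b)"
proof -
  have "coboundary A M h = 0 \<longleftrightarrow>
     (\<forall>a b. h (mul A a b) = lact M a (h b) + ract M (h a) b) \<and>
     (\<forall>a b. h (br A a b) = lbr M a (h b) + rbr M (h a) b)"
    by (simp add: coboundary_def zero_prod_def fun_eq_iff algebra_simps)
  then show ?thesis by (simp add: cocycles_neg1_def)
qed

text \<open>Multiplying or bracketing an element of \<open>M\<close> with \<open>e\<close> depends
  only on \<open>p e\<close>, so the cocycle identities of \<open>h\<close> are exactly the
  derivation rules of \<open>sigma h\<close>.\<close>

lemma sigma_mem:
  assumes "h \<in> carrier (cocycles_neg1 A M)"
  shows "sigma h \<in> carrier (Der_rel E i)"
proof -
  have h: "Vector_Spaces.linear (scl A) (rscl M) h"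
    using assms by (simp add: cocycles_neg1_iff)
  show ?thesis
    using assms unfolding Der_rel_iff Der_AWB_def cocycles_neg1_iff Vector_Spaces.linear_iff
    by (simp add: sigma_def p_simps linearD[OF h] i_simps p_mul p_br induced
        ext.vector_space_axioms)
qed

lemma linear_map_sigma: "linear_map class_ring (cocycles_neg1 A M) (Der_rel E i) sigma"
  by (rule linear_map_class_ringI[OF rep.vectorspace_cocycles_neg1 vectorspace_Der_rel sigma_mem])
    (simp_all add: cocycles_neg1_def Der_rel_def sigma_def fun_scl_def fun_eq_iff i_simps)

lemma inj_sigma: "inj sigma"
proof (rule injI)
  fix h h'
  assume "sigma h = sigma h'"
  then have "sigma h (s a) = sigma h' (s a)" for a by simp
  then show "h = h'" by (simp add: sigma_def fun_eq_iff)
qed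

lemma sigma_image:
  "sigma ` carrier (cocycles_neg1 A M)
     = {d \<in> carrier (Der_rel E i). kappa_via i p s d = 0}"
proof (intro equalityI subsetI)
  fix d
  assume "d \<in> sigma ` carrier (cocycles_neg1 A M)"
  then obtain h where h: "h \<in> carrier (cocycles_neg1 A M)" and d: "d = sigma h" by blast
  \<comment> \<open>Needed for \<open>sigma h\<close> to vanish on \<open>M\<close>, where
    \<open>p\<close> is zero.\<close>
  have "h 0 = 0"
    using h linearD(4)[of "scl A" "rscl M" h] by (simp add: cocycles_neg1_iff)
  then show "d \<in> {d \<in> carrier (Der_rel E i). kappa_via i p s d = 0}"
    using sigma_mem[OF h] by (simp add: d zero_prod_def kappa_via_eq_iff) (simp add: sigma_def i_simps)
next
  fix d
  assume "d \<in> {d \<in> carrier (Der_rel E i). kappa_via i p s d = 0}"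
  then have d: "d \<in> carrier (Der_rel E i)" and "kappa_via i p s d = 0" by auto
  then have di: "d (i m) = 0" and pd: "p (d e) = 0" for m e
    by (simp_all add: zero_prod_def kappa_via_eq_iff i_simps)
  have Der: "d \<in> Der_AWB E" using d by (simp add: Der_rel_iff)
  note simps = linearD[OF ext.Der_linear[OF Der]] ext.Der_simps[OF Der]
  \<comment> \<open>\<open>p \<circ> d = 0\<close> puts the values of \<open>d\<close> into
    \<open>M\<close>, so they have preimages under \<open>i\<close>.\<close>
  define h where "h a = inv_into UNIV i (d (s a))" for a
  have ih: "i (h a) = d (s a)" for a by (simp add: h_def i_inv_i pd)
  have dh: "d e = i (h (p e))" for e
  proof -
    obtain a m where "e = s a + i m" by (rule decompose)
    then show ?thesis by (simp add: simps di ih p_simps)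
  qed
  have "Vector_Spaces.linear (scl A) (rscl M) h"
    unfolding Vector_Spaces.linear_iff i_eq_iff[symmetric] i_simps ih
    by (simp add: s_simps simps rep.alg.vector_space_axioms rep.rep.vector_space_axioms)
  moreover have "h (mul A a b) = lact M a (h b) + ract M (h a) b"
    and "h (br A a b) = lbr M a (h b) + rbr M (h a) b" for a b
    \<comment> \<open>The product of \<open>s a\<close> and \<open>s b\<close> lies over that of
      \<open>a\<close> and \<open>b\<close>, as does \<open>s\<close> of the latter. Evaluating
      \<open>d\<close> at the product of the lifts gives its derivation rule without a factor set
      term; likewise for the bracket.\<close>
    using dh[of "mul E (s a) (s b)"] dh[of "br E (s a) (s b)"]
    unfolding i_eq_iff[symmetric] i_simps i_act ih by (simp_all add: p_mul p_br simps ih)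
  ultimately have "h \<in> carrier (cocycles_neg1 A M)"
    by (simp add: cocycles_neg1_iff)
  moreover have "d = sigma h" by (simp add: sigma_def fun_eq_iff dh)
  ultimately show "d \<in> sigma ` carrier (cocycles_neg1 A M)" by blast
qed

section \<open>The Wells map: linearity and independence of the section\<close>

lemma wells_via_eq:
  "wells_via A M E i s (dM, dA) = cl A M (theta dM dA factor_mul, theta dM dA factor_br)"
  by (simp add: wells_via_def section_cocycle_eq)

lemma wells_via_mem:
  assumes "v \<in> carrier (D_AWB A M)"
  shows "wells_via A M E i s v \<in> carrier (H1_AWB A M)"
  using assms rep.theta_cocycle[OF _ section_cocycle_cocycle]
  by (cases v) (auto simp: wells_via_eq rep.H1_simps)

lemma linear_map_wells: "linear_map class_ring (D_AWB A M) (H1_AWB A M) (wells_via A M E i s)"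
proof (rule linear_map_class_ringI[OF rep.vectorspace_D_AWB rep.vectorspace_H1 wells_via_mem])
  have factor_mul: "bilinear_map (scl A) (scl A) (rscl M) factor_mul"
    and factor_br: "bilinear_map (scl A) (scl A) (rscl M) factor_br"
    using section_cocycle_cocycle by (simp_all add: rep.cocycles0_iff)
  \<comment> \<open>Bilinearity of \<open>b\<close> makes \<open>theta\<close> linear in the pair,
    since \<open>dA\<close> enters through the arguments of \<open>b\<close>.\<close>
  have theta_add: "theta (dM + dM') (dA + dA') b = theta dM dA b + theta dM' dA' b"
    and theta_scl: "theta (fun_scl (rscl M) c dM) (fun_scl (scl A) c dA) b
      = fun_scl (fun_scl (rscl M)) c (theta dM dA b)"
    if b: "bilinear_map (scl A) (scl A) (rscl M) b" for b dM dM' dA dA' c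
    by (simp_all add: theta_def fun_scl_def fun_eq_iff bilinear_mapD[OF b]
        rep.rep.scale_right_diff_distrib)
  fix v
  assume "v \<in> carrier (D_AWB A M)"
  obtain dM dA where v: "v = (dM, dA)" by fastforce
  show "wells_via A M E i s (v \<oplus>\<^bsub>D_AWB A M\<^esub> w)
      = wells_via A M E i s v \<oplus>\<^bsub>H1_AWB A M\<^esub> wells_via A M E i s w" for w
    using theta_add[OF factor_mul] theta_add[OF factor_br]
    by (cases w) (simp add: v D_AWB_def wells_via_eq rep.H1_simps)
  show "wells_via A M E i s (c \<odot>\<^bsub>D_AWB A M\<^esub> v) = c \<odot>\<^bsub>H1_AWB A M\<^esub> wells_via A M E i s v" for c
    by (simp add: v D_AWB_def pair_scl_def[of "fun_scl (rscl M)"] wells_via_eq rep.H1_simps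
        theta_scl[OF factor_mul] theta_scl[OF factor_br])
      (simp add: pair_scl_def)
qed (assumption)

text \<open>Two sections differ by a map \<open>t\<close> into \<open>M\<close>. Replacing
  \<open>s\<close> by \<open>s + i \<circ> t\<close> changes the factor set by terms linear in
  \<open>t\<close>, which form a coboundary, and by a quadratic term, which is zero because
  \<open>M\<close> is abelian.\<close>

lemma section_cocycle_diff:
  assumes "linear_section A E p s'"
  shows "section_cocycle A E i s - section_cocycle A E i s' \<in> coboundaries0 A M"
proof -
  interpret s': extension_section A M E i p s'
    using assms by unfold_locales
  define t where "t a = inv_into UNIV i (s' a - s a)" for a
  have it: "i (t a) = s' a - s a" for a
    by (simp add: t_def i_inv_i p_simps)
  then have s': "s' a = s a + i (t a)" for a by simp
  have "Vector_Spaces.linear (scl A) (rscl M) t"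
    unfolding Vector_Spaces.linear_iff i_eq_iff[symmetric]
    by (simp add: i_simps it s_simps s'.s_simps rep.alg.vector_space_axioms
        rep.rep.vector_space_axioms ext.scale_right_diff_distrib)
  moreover have "coboundary A M t = (factor_mul - s'.factor_mul, factor_br - s'.factor_br)"
    by (subst coboundary_eq_iff[OF refl])
      (simp add: i_simps i_factor_mul i_factor_br s'.i_factor_mul s'.i_factor_br s'
        ext.bilinear_simps mul_i_i br_i_i)
  ultimately show ?thesis
    by (simp add: rep.coboundaries0I section_cocycle_eq s'.section_cocycle_eq)
qed

text \<open>\<open>theta\<close> is additive in the cochain, so the two representatives differ by
  \<open>theta\<close> applied to a coboundary, which is again a coboundary.\<close>

lemma wells_via_cong:
  assumes "linear_section A E p s'" "v \<in> carrier (D_AWB A M)"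
  shows "wells_via A M E i s v = wells_via A M E i s' v"
proof -
  interpret s': extension_section A M E i p s'
    using assms(1) by unfold_locales
  obtain dM dA where v: "v = (dM, dA)" by fastforce
  with assms(2) have D: "(dM, dA) \<in> carrier (D_AWB A M)" by simp
  have "theta dM dA b - theta dM dA b' = theta dM dA (b - b')" for b b'
    by (simp add: theta_def fun_eq_iff rep.D_AWB_simps[OF D])
  then have "(theta dM dA factor_mul, theta dM dA factor_br)
        - (theta dM dA s'.factor_mul, theta dM dA s'.factor_br)
      = (theta dM dA (factor_mul - s'.factor_mul), theta dM dA (factor_br - s'.factor_br))"
    by simp
  also have "\<dots> \<in> coboundaries0 A M"
    using section_cocycle_diff[OF assms(1)]
    by (intro rep.theta_coboundary[OF D]) (simp add: section_cocycle_eq s'.section_cocycle_eq)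
  finally show ?thesis
    by (simp add: v wells_via_eq s'.wells_via_eq rep.cl_eq_iff)
qed

lemma kappa_via_cong:
  assumes "linear_section A E p s'" "d \<in> carrier (Der_rel E i)"
  shows "kappa_via i p s d = kappa_via i p s' d"
proof -
  interpret s': extension_section A M E i p s'
    using assms(1) by unfold_locales
  show ?thesis
    using kappa_via_eq_iff[OF assms(2)] s'.kappa_via_eq_iff[OF assms(2)]
    by (metis prod.collapse)
qed

section \<open>Exactness at the pairs of derivations\<close>

lemma wells_kappa_eq_0:
  assumes d: "d \<in> carrier (Der_rel E i)"
  shows "wells_via A M E i s (kappa_via i p s d) = \<zero>\<^bsub>H1_AWB A M\<^esub>"
proof -
  obtain dM dA where \<kappa>: "kappa_via i p s d = (dM, dA)" by fastforce
  then have idM: "i (dM m) = d (i m)" and dA: "dA (p e) = p (d e)" for m e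
    using kappa_via_simps[OF d] by simp_all
  have D: "(dM, dA) \<in> carrier (D_AWB A M)"
    using kappa_via_mem[OF d] \<kappa> by simp
  have Der: "d \<in> Der_AWB E" using d by (simp add: Der_rel_iff)
  note simps = linearD[OF ext.Der_linear[OF Der]] ext.Der_simps[OF Der]
  \<comment> \<open>Both \<open>s (dA a)\<close> and \<open>d (s a)\<close> lie over
    \<open>dA a\<close>, so their difference comes from \<open>M\<close>; it measures how far
    \<open>s\<close> is from intertwining \<open>dA\<close> and \<open>d\<close>.\<close>
  define h where "h a = inv_into UNIV i (s (dA a) - d (s a))" for a
  have ih: "i (h a) = s (dA a) - d (s a)" for a
    using dA[of "s a"] by (simp add: h_def i_inv_i p_simps)
  have "Vector_Spaces.linear (scl A) (rscl M) h"
    unfolding Vector_Spaces.linear_iff i_eq_iff[symmetric]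
    by (simp add: i_simps ih s_simps simps rep.D_AWB_simps[OF D] rep.alg.vector_space_axioms
        rep.rep.vector_space_axioms ext.scale_right_diff_distrib)
  moreover have "coboundary A M h = (theta dM dA factor_mul, theta dM dA factor_br)"
    \<comment> \<open>By the derivation rule, the terms with \<open>d\<close> regroup into
      \<open>d\<close> of the factor set, where \<open>d\<close> acts as \<open>dM\<close>. The
      terms with \<open>s \<circ> dA\<close> give the factor set with \<open>dA\<close> applied to
      one argument.\<close>
    by (subst coboundary_eq_iff[OF ih])
      (simp add: theta_def i_simps i_factor_mul i_factor_br idM s_simps simps ext.bilinear_simps
        rep.D_AWB_simps[OF D] algebra_simps)
  ultimately show ?thesis
    by (simp add: \<kappa> wells_via_eq rep.H1_simps rep.coboundaries0I)
qed

lemma wells_eq_0_imp_kappa: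
  assumes D: "(dM, dA) \<in> carrier (D_AWB A M)"
    and "wells_via A M E i s (dM, dA) = \<zero>\<^bsub>H1_AWB A M\<^esub>"
  obtains d where "d \<in> carrier (Der_rel E i)" "kappa_via i p s d = (dM, dA)"
proof -
  obtain h where h: "Vector_Spaces.linear (scl A) (rscl M) h"
    and "coboundary A M h = (theta dM dA factor_mul, theta dM dA factor_br)"
    using assms(2) by (auto simp: wells_via_eq rep.H1_simps coboundaries0_def)
  then have
    "i (theta dM dA factor_mul a b) = i (h (mul A a b)) - mul E (s a) (i (h b)) - mul E (i (h a)) (s b)"
    "i (theta dM dA factor_br a b) = i (h (br A a b)) - br E (s a) (i (h b)) - br E (i (h a)) (s b)" for a b
    by (simp_all add: coboundary_eq_iff[OF refl])
  \<comment> \<open>Solved for \<open>dM\<close> of the factor set, the form in which it appears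
    when \<open>d\<close> is applied to a product or bracket of lifts.\<close>
  then have i_dM:
    "i (dM (factor_mul a b)) = i (h (mul A a b)) - mul E (s a) (i (h b)) - mul E (i (h a)) (s b)
       + i (factor_mul (dA a) b) + i (factor_mul a (dA b))"
    "i (dM (factor_br a b)) = i (h (br A a b)) - br E (s a) (i (h b)) - br E (i (h a)) (s b)
       + i (factor_br (dA a) b) + i (factor_br a (dA b))" for a b
    by (simp_all add: theta_def i_simps algebra_simps)
  \<comment> \<open>The preceding lemma forces this choice: there \<open>h\<close> is the difference
    of \<open>s \<circ> dA\<close> and \<open>d \<circ> s\<close>, and on \<open>M\<close> the map
    must be \<open>dM\<close>. The inverse image is the \<open>M\<close>-component of
    \<open>e\<close>.\<close>
  define d where
    "d e = s (dA (p e)) - i (h (p e)) + i (dM (inv_into UNIV i (e - s (p e))))" for e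
  have d: "d (s a + i m) = s (dA a) - i (h a) + i (dM m)" for a m
    by (simp add: d_def p_simps)
  note simps = i_simps s_simps linearD[OF h] rep.D_AWB_simps[OF D]
  have "d (x + y) = d x + d y" "d (scl E c x) = scl E c (d x)"
    "d (mul E x y) = mul E x (d y) + mul E (d x) y"
    "d (br E x y) = br E x (d y) + br E (d x) y" for x y c
  proof -
    obtain a m where x: "x = s a + i m" by (rule decompose)
    obtain b n where y: "y = s b + i n" by (rule decompose)
    note expand = simps i_act i_factor_mul i_factor_br ext.bilinear_simps mul_i_i br_i_i
      ext.scale_right_distrib ext.scale_right_diff_distrib
    have "x + y = s (a + b) + i (m + n)"
      by (simp add: x y expand)
    then show "d (x + y) = d x + d y"
      unfolding x y by (simp only: d) (simp add: expand)
    have "scl E c x = s (scl A c a) + i (rscl M c m)"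
      by (simp add: x expand)
    then show "d (scl E c x) = scl E c (d x)"
      unfolding x by (simp only: d) (simp add: expand)
    \<comment> \<open>The components of a product: the factor set corrects the product of the lifts,
      the mixed terms are the two actions, and the product of \<open>i m\<close> and
      \<open>i n\<close> vanishes.\<close>
    have "mul E x y = s (mul A a b) + i (factor_mul a b + lact M a n + ract M m b)"
      by (simp add: x y expand)
    then show "d (mul E x y) = mul E x (d y) + mul E (d x) y"
      unfolding x y by (simp only: d) (simp add: expand i_dM algebra_simps)
    have "br E x y = s (br A a b) + i (factor_br a b + lbr M a n + rbr M m b)"
      by (simp add: x y expand)
    then show "d (br E x y) = br E x (d y) + br E (d x) y"
      unfolding x y by (simp only: d) (simp add: expand i_dM algebra_simps)
  qed
  then have "d \<in> Der_AWB E"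
    by (simp add: Der_AWB_def Vector_Spaces.linear_iff ext.vector_space_axioms)
  moreover have d_i: "d (i m) = i (dM m)" for m
    using d[of 0 m] by (simp add: simps)
  ultimately have Der: "d \<in> carrier (Der_rel E i)"
    by (simp add: Der_rel_iff)
  have "p (d e) = dA (p e)" for e
    by (simp add: d_def p_simps)
  then have "kappa_via i p s d = (dM, dA)"
    by (simp add: kappa_via_eq_iff[OF Der] d_i)
  with Der show ?thesis by (rule that)
qed

lemma kappa_image:
  "kappa_via i p s ` carrier (Der_rel E i)
     = {v \<in> carrier (D_AWB A M). wells_via A M E i s v = \<zero>\<^bsub>H1_AWB A M\<^esub>}"
proof (intro equalityI subsetI)
  fix v
  assume "v \<in> kappa_via i p s ` carrier (Der_rel E i)"
  then show "v \<in> {v \<in> carrier (D_AWB A M). wells_via A M E i s v = \<zero>\<^bsub>H1_AWB A M\<^esub>}"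
    by (auto simp: kappa_via_mem wells_kappa_eq_0)
next
  fix v
  assume "v \<in> {v \<in> carrier (D_AWB A M). wells_via A M E i s v = \<zero>\<^bsub>H1_AWB A M\<^esub>}"
  moreover obtain dM dA where "v = (dM, dA)" by fastforce
  ultimately obtain d where "d \<in> carrier (Der_rel E i)" "kappa_via i p s d = v"
    using wells_eq_0_imp_kappa by blast
  then show "v \<in> kappa_via i p s ` carrier (Der_rel E i)" by blast
qed

end

theorem theorem3p9:
  fixes A :: "('k::field, 'a::ab_group_add) awb"
    and M :: "('k, 'a, 'm::ab_group_add) awb_rep"
    and E :: "('k, 'e::ab_group_add) awb"
    and i :: "'m \<Rightarrow> 'e"
    and p :: "'e \<Rightarrow> 'a"
  assumes "abelian_extension A M E i p"
  shows "(\<exists>s. linear_section A E p s) \<and>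
    (\<exists>\<sigma> \<kappa> \<omega>.
      (\<forall>s. linear_section A E p s \<longrightarrow>
         (\<forall>d\<in>carrier (Der_rel E i). \<kappa> d = kappa_via i p s d) \<and>
         (\<forall>d\<in>carrier (D_AWB A M). \<omega> d = wells_via A M E i s d)) \<and>
      linear_map class_ring (cocycles_neg1 A M) (Der_rel E i) \<sigma> \<and>
      linear_map class_ring (Der_rel E i) (D_AWB A M) \<kappa> \<and>
      linear_map class_ring (D_AWB A M) (H1_AWB A M) \<omega> \<and>
      inj_on \<sigma> (carrier (cocycles_neg1 A M)) \<and>
      mod_hom.im (cocycles_neg1 A M) \<sigma> = mod_hom.ker (Der_rel E i) (D_AWB A M) \<kappa> \<and>
      mod_hom.im (Der_rel E i) \<kappa> = mod_hom.ker (D_AWB A M) (H1_AWB A M) \<omega>)"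
proof -
  interpret abelian_extension A M E i p by fact
  obtain s where s: "linear_section A E p s"
    using ex_linear_section by blast
  interpret extension_section A M E i p s
    using s by unfold_locales
  have "\<zero>\<^bsub>D_AWB A M\<^esub> = 0" by (simp add: D_AWB_def)
  then have "mod_hom.im (cocycles_neg1 A M) sigma
      = mod_hom.ker (Der_rel E i) (D_AWB A M) (kappa_via i p s)"
    using sigma_image
    by (simp add: linear_map_im[OF linear_map_sigma] linear_map_ker[OF linear_map_kappa])
  moreover have "mod_hom.im (Der_rel E i) (kappa_via i p s)
      = mod_hom.ker (D_AWB A M) (H1_AWB A M) (wells_via A M E i s)"
    using kappa_image
    by (simp add: linear_map_im[OF linear_map_kappa] linear_map_ker[OF linear_map_wells])
  moreover have "inj_on sigma (carrier (cocycles_neg1 A M))"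
    using inj_sigma by (rule inj_on_subset) simp
  \<comment> \<open>The three maps are built from the one section \<open>s\<close>; the two
    congruence lemmas show that any other section yields the same values.\<close>
  ultimately show ?thesis
    using s kappa_via_cong wells_via_cong linear_map_sigma linear_map_kappa linear_map_wells
    by (intro conjI exI[of _ s] exI[of _ sigma] exI[of _ "kappa_via i p s"]
        exI[of _ "wells_via A M E i s"]) blast+
qed

end
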